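(* Let $G \in \mathscr{S}$ be such that every infinite commensurated compact subgroup of $G$ is open. Let $H$ be a non-trivial compact locally normal subgroup of $G$. Then there exist $g_1, \dots, g_n \in G$ such that $$G = \langle g_1Hg_1^{-1}, g_2Hg_2^{-1}, \dots, g_nHg_n^{-1} \rangle$$ (generation as an abstract group).
   Context: $\mathscr{S}$ is the class of non-discrete, compactly generated, topologically simple, totally disconnected locally compact groups (topologically simple: non-trivial, and the only closed normal subgroups are $\{1\}$ and the whole group). A subgroup of a topological group $G$ is locally normal in $G$ if its normaliser in $G$ is open. A subgroup $K \le G$ is commensurated (by $G$) if for every $g \in G$ the index $|K : K \cap gKg^{-1}|$ is finite. *)

theory Defs
  imports
    "HOL-Analysis.Analysis"
    "HOL-Algebra.Group_Action"
    "HOL-Algebra.Generated_Groups"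
begin

locale topological_group = group G for G (structure) +
  fixes T :: "'a topology"
  assumes topspace_eq_carrier: "topspace T = carrier G"
    and continuous_mult: "continuous_map (prod_topology T T) T (\<lambda>(x, y). x \<otimes> y)"
    and continuous_inv: "continuous_map T T (\<lambda>x. inv x)"

definition totally_disconnected_space :: "'a topology \<Rightarrow> bool" where
  "totally_disconnected_space T \<longleftrightarrow>
     (\<forall>x \<in> topspace T. connected_component_of_set T x = {x})"

definition compactly_generated_group :: "('a, 'b) monoid_scheme \<Rightarrow> 'a topology \<Rightarrow> bool" where
  "compactly_generated_group G T \<longleftrightarrow> (\<exists>K. compactin T K \<and> generate G K = carrier G)"

definition topologically_simple :: "('a, 'b) monoid_scheme \<Rightarrow> 'a topology \<Rightarrow> bool" where
  "topologically_simple G T \<longleftrightarrow>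
     carrier G \<noteq> {\<one>\<^bsub>G\<^esub>} \<and>
     (\<forall>N. N \<lhd> G \<and> closedin T N \<longrightarrow> N = {\<one>\<^bsub>G\<^esub>} \<or> N = carrier G)"

(* The Hausdorff axiom is not listed: a topological group is Hausdorff as soon as it is
   totally disconnected, because the closure of the trivial subgroup is connected. *)
definition class_S :: "('a, 'b) monoid_scheme \<Rightarrow> 'a topology \<Rightarrow> bool" where
  "class_S G T \<longleftrightarrow>
     topological_group G T \<and>
     locally_compact_space T \<and>
     totally_disconnected_space T \<and>
     T \<noteq> discrete_topology (carrier G) \<and>
     compactly_generated_group G T \<and>
     topologically_simple G T"

definition conjugate_set :: "('a, 'b) monoid_scheme \<Rightarrow> 'a \<Rightarrow> 'a set \<Rightarrow> 'a set" where
  "conjugate_set G g H = g <#\<^bsub>G\<^esub> H #>\<^bsub>G\<^esub> inv\<^bsub>G\<^esub> g"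

definition locally_normal :: "('a, 'b) monoid_scheme \<Rightarrow> 'a topology \<Rightarrow> 'a set \<Rightarrow> bool" where
  "locally_normal G T H \<longleftrightarrow> subgroup H G \<and> openin T (normalizer G H)"

(* Finiteness of an index is finiteness of the set of cosets; comparing cardinals of type nat
   would not do, since card is 0 on infinite sets. *)
definition commensurated :: "('a, 'b) monoid_scheme \<Rightarrow> 'a set \<Rightarrow> bool" where
  "commensurated G K \<longleftrightarrow>
     subgroup K G \<and>
     (\<forall>g \<in> carrier G. finite (rcosets\<^bsub>G\<lparr>carrier := K\<rparr>\<^esub> (K \<inter> conjugate_set G g K)))"

end

theory Submission
  imports Defs
begin

text \<open>By topological simplicity the normal closure of \<open>H\<close> is dense, so, \<open>G\<close> being compactly generated,
  every open subgroup together with finitely many conjugates of \<open>H\<close> generates \<open>G\<close>. Apply this to a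
  compact open subgroup \<open>U\<close>, and enlarge the resulting set \<open>\<L>\<close> of conjugates so that it is still
  finite but invariant under \<open>U\<close>. The elements of \<open>U\<close> normalising every \<open>L \<in> \<L>\<close> form an open
  subgroup \<open>V\<close>, and the product \<open>K\<close> of the groups \<open>L \<inter> V\<close> is compact, normalised by \<open>U\<close> and
  commensurated by every \<open>L \<in> \<L>\<close>, hence by \<open>G\<close>. It is infinite, because a finite \<open>H\<close> would have
  an open centraliser; so \<open>K\<close> is open by hypothesis. As \<open>K\<close> lies in the group generated by \<open>\<L>\<close>,
  the first remark applied to \<open>K\<close> gives the claim.\<close>

section \<open>Conjugates of subsets and their normalisers\<close>

context group
begin

lemma conjugate_set_eq_image: "conjugate_set G g H = (\<lambda>h. g \<otimes> h \<otimes> inv g) ` H"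
  unfolding conjugate_set_def l_coset_def r_coset_def by auto

lemma mem_l_coset_self: "\<lbrakk>g \<in> carrier G; \<one> \<in> V\<rbrakk> \<Longrightarrow> g \<in> g <# V"
  unfolding l_coset_def by (rule UN_I[of \<one>]) simp_all

lemma subset_set_mult_one: "\<lbrakk>A \<subseteq> carrier G; \<one> \<in> V\<rbrakk> \<Longrightarrow> A \<subseteq> A <#> V"
  using mem_l_coset_self unfolding set_mult_def l_coset_def by blast

lemma conjugate_set_subset_carrier:
  "\<lbrakk>g \<in> carrier G; H \<subseteq> carrier G\<rbrakk> \<Longrightarrow> conjugate_set G g H \<subseteq> carrier G"
  by (auto simp: conjugate_set_eq_image)

lemma conjugate_set_mult:
  assumes "g \<in> carrier G" "h \<in> carrier G" "H \<subseteq> carrier G"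
  shows "conjugate_set G (g \<otimes> h) H = conjugate_set G g (conjugate_set G h H)"
proof -
  have "(g \<otimes> h) \<otimes> x \<otimes> inv (g \<otimes> h) = g \<otimes> (h \<otimes> x \<otimes> inv h) \<otimes> inv g" if "x \<in> H" for x
  proof -
    have "x \<in> carrier G" using that assms by auto
    with assms show ?thesis by (simp add: inv_mult_group m_assoc)
  qed
  then show ?thesis by (auto simp: conjugate_set_eq_image image_image)
qed

lemma conjugate_set_one: "H \<subseteq> carrier G \<Longrightarrow> conjugate_set G \<one> H = H"
  by (force simp: conjugate_set_eq_image image_iff)

lemma conjugate_set_hom: "g \<in> carrier G \<Longrightarrow> (\<lambda>h. g \<otimes> h \<otimes> inv g) \<in> hom G G"
  by (rule homI) (auto simp: m_assoc inv_solve_left)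

lemma subgroup_conjugate_set:
  assumes "g \<in> carrier G" "subgroup H G"
  shows "subgroup (conjugate_set G g H) G"
proof -
  interpret group_hom G G "\<lambda>h. g \<otimes> h \<otimes> inv g"
    using conjugate_set_hom[OF assms(1)] by unfold_locales
  show ?thesis unfolding conjugate_set_eq_image by (rule subgroup_img_is_subgroup[OF assms(2)])
qed

lemma mem_normalizer_iff:
  "H \<subseteq> carrier G \<Longrightarrow> g \<in> normalizer G H \<longleftrightarrow> g \<in> carrier G \<and> conjugate_set G g H = H"
  by (auto simp: normalizer_def stabilizer_def conjugate_set_def)

text \<open>Conjugating back by \<open>inv g\<close> turns the condition on the conjugate into one
  on \<open>H\<close>. Written in this form, the normaliser is the preimage of
  \<open>normalizer G H\<close> under a map that will be continuous, so that openness passes to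
  conjugates.\<close>

lemma normalizer_conjugate_set:
  assumes "g \<in> carrier G" "H \<subseteq> carrier G"
  shows "normalizer G (conjugate_set G g H) = {x \<in> carrier G. inv g \<otimes> x \<otimes> g \<in> normalizer G H}"
proof -
  have "conjugate_set G x (conjugate_set G g H) = conjugate_set G g H
      \<longleftrightarrow> conjugate_set G (inv g \<otimes> x \<otimes> g) H = H" if x: "x \<in> carrier G" for x
  proof -
    let ?A = "conjugate_set G x (conjugate_set G g H)"
    have "conjugate_set G (inv g \<otimes> x \<otimes> g) H = conjugate_set G (inv g) ?A"
      using assms x by (simp add: conjugate_set_mult conjugate_set_subset_carrier m_assoc)
    moreover have "conjugate_set G (inv g) (conjugate_set G g B) = B"
      "conjugate_set G g (conjugate_set G (inv g) B) = B" if "B \<subseteq> carrier G" for B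
      using assms that by (simp_all flip: conjugate_set_mult add: conjugate_set_one)
    ultimately show ?thesis
      using assms x by (metis conjugate_set_subset_carrier)
  qed
  then show ?thesis
    using assms by (auto simp: mem_normalizer_iff conjugate_set_subset_carrier)
qed

section \<open>Generated subgroups: finite subfamilies and conjugation\<close>

text \<open>An element of a generated subgroup is a finite word, so its letters come from finitely
  many members of \<C>. This is how finitely many conjugates of \<open>H\<close> come to
  suffice.\<close>

lemma generate_Union_finite_subset:
  assumes "x \<in> generate G (\<Union>\<C>)"
  shows "\<exists>\<F>. finite \<F> \<and> \<F> \<subseteq> \<C> \<and> x \<in> generate G (\<Union>\<F>)"
  using assms
proof (induction rule: generate.induct)
  case one
  show ?case by (intro exI[of _ "{}"]) (auto intro: generate.one)
next
  case (incl h)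
  then obtain C where "C \<in> \<C>" "h \<in> C" by auto
  then show ?case by (intro exI[of _ "{C}"]) (auto intro: generate.incl)
next
  case (inv h)
  then obtain C where "C \<in> \<C>" "h \<in> C" by auto
  then show ?case by (intro exI[of _ "{C}"]) (auto intro: generate.inv)
next
  case (eng h1 h2)
  then obtain \<F>1 \<F>2 where "finite \<F>1" "\<F>1 \<subseteq> \<C>" "h1 \<in> generate G (\<Union>\<F>1)"
    "finite \<F>2" "\<F>2 \<subseteq> \<C>" "h2 \<in> generate G (\<Union>\<F>2)" by blast
  moreover have "generate G (\<Union>\<F>1) \<subseteq> generate G (\<Union>(\<F>1 \<union> \<F>2))"
    "generate G (\<Union>\<F>2) \<subseteq> generate G (\<Union>(\<F>1 \<union> \<F>2))"
    by (auto intro!: mono_generate)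
  ultimately show ?case by (intro exI[of _ "\<F>1 \<union> \<F>2"]) (auto intro!: generate.eng)
qed

lemma finite_subset_generate_Union:
  assumes "finite F" "F \<subseteq> generate G (\<Union>\<C>)"
  shows "\<exists>\<F>. finite \<F> \<and> \<F> \<subseteq> \<C> \<and> F \<subseteq> generate G (\<Union>\<F>)"
  using assms
proof (induction F)
  case empty
  then show ?case by auto
next
  case (insert x F)
  then obtain \<F>1 where 1: "finite \<F>1" "\<F>1 \<subseteq> \<C>" "F \<subseteq> generate G (\<Union>\<F>1)" by auto
  obtain \<F>2 where 2: "finite \<F>2" "\<F>2 \<subseteq> \<C>" "x \<in> generate G (\<Union>\<F>2)"
    using generate_Union_finite_subset[of x \<C>] insert.prems by auto
  have "generate G (\<Union>\<F>1) \<subseteq> generate G (\<Union>(\<F>1 \<union> \<F>2))"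
    "generate G (\<Union>\<F>2) \<subseteq> generate G (\<Union>(\<F>1 \<union> \<F>2))"
    by (auto intro!: mono_generate)
  with 1 2 show ?case by (intro exI[of _ "\<F>1 \<union> \<F>2"]) auto
qed

text \<open>Conjugation by \<open>g\<close> is an endomorphism, hence maps the subgroup generated by
  \<open>X\<close> onto the one generated by the image of \<open>X\<close>.\<close>

lemma generate_conjugation_closed:
  assumes "g \<in> carrier G" "X \<subseteq> carrier G" "\<And>x. x \<in> X \<Longrightarrow> g \<otimes> x \<otimes> inv g \<in> X" "k \<in> generate G X"
  shows "g \<otimes> k \<otimes> inv g \<in> generate G X"
proof -
  interpret group_hom G G "\<lambda>h. g \<otimes> h \<otimes> inv g"
    using conjugate_set_hom[OF assms(1)] by unfold_locales
  have "(\<lambda>h. g \<otimes> h \<otimes> inv g) ` generate G X = generate G ((\<lambda>h. g \<otimes> h \<otimes> inv g) ` X)"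
    by (rule generate_img[OF assms(2), symmetric])
  also have "\<dots> \<subseteq> generate G X"
    by (rule mono_generate) (use assms(3) in blast)
  finally have "(\<lambda>h. g \<otimes> h \<otimes> inv g) ` generate G X \<subseteq> generate G X" .
  then show ?thesis using assms(4) by auto
qed

lemma generate_eqI:
  assumes "generate G X = carrier G" "X \<subseteq> generate G Y" "Y \<subseteq> carrier G"
  shows "generate G Y = carrier G"
  using assms generate_subgroup_incl[OF assms(2) generate_is_subgroup[OF assms(3)]] generate_incl by blast

lemma generate_Union_conjugation_normal:
  assumes "H \<subseteq> carrier G"
  shows "generate G (\<Union>g\<in>carrier G. conjugate_set G g H) \<lhd> G"
proof (rule normal_generateI)
  show "(\<Union>g\<in>carrier G. conjugate_set G g H) \<subseteq> carrier G"
    using assms by (auto dest: subsetD[OF conjugate_set_subset_carrier])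
next
  fix h x assume "h \<in> (\<Union>g\<in>carrier G. conjugate_set G g H)" and x: "x \<in> carrier G"
  then obtain g where g: "g \<in> carrier G" "h \<in> conjugate_set G g H" by auto
  then have "x \<otimes> h \<otimes> inv x \<in> conjugate_set G x (conjugate_set G g H)"
    by (auto simp: conjugate_set_eq_image[of x])
  then have "x \<otimes> h \<otimes> inv x \<in> conjugate_set G (x \<otimes> g) H"
    using assms x g by (simp add: conjugate_set_mult)
  then show "x \<otimes> h \<otimes> inv x \<in> (\<Union>g\<in>carrier G. conjugate_set G g H)" using x g by blast
qed

section \<open>Commensuration expressed through cosets\<close>

text \<open>The condition \<open>K g \<subseteq> F K\<close> with \<open>F\<close> finite says that \<open>K g K\<close> is a finite union of left
  cosets, i.e. that \<open>K \<inter> g K g\<^sup>-\<^sup>1\<close> has finite index in \<open>K\<close>; in this form it is visibly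
  multiplicative in \<open>g\<close>, so it needs checking on generators only.\<close>

definition coset_finite :: "'a set \<Rightarrow> 'a \<Rightarrow> bool" where
  "coset_finite K g \<longleftrightarrow> (\<exists>F. finite F \<and> F \<subseteq> carrier G \<and> K #> g \<subseteq> F <#> K)"

text \<open>With \<open>F\<close> for \<open>g\<close> and \<open>F'\<close> for \<open>h\<close>,
  the chain K g h \<subseteq> F K h \<subseteq> F F' K shows that the finite set
  \<open>F <#> F'\<close> serves for the product.\<close>

lemma coset_finite_mult:
  assumes "subgroup K G" "g \<in> carrier G" "h \<in> carrier G" "coset_finite K g" "coset_finite K h"
  shows "coset_finite K (g \<otimes> h)"
proof -
  from assms obtain F F' where F: "finite F" "F \<subseteq> carrier G" "K #> g \<subseteq> F <#> K"
    and F': "finite F'" "F' \<subseteq> carrier G" "K #> h \<subseteq> F' <#> K"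
    unfolding coset_finite_def by auto
  have K: "K \<subseteq> carrier G" by (rule subgroup.subset[OF assms(1)])
  have "K #> (g \<otimes> h) = (K #> g) #> h" by (simp add: coset_mult_assoc assms K)
  also have "\<dots> \<subseteq> (F <#> K) #> h" using F(3) by (auto simp: r_coset_def)
  also have "\<dots> = F <#> (K #> h)" by (simp add: setmult_rcos_assoc K F assms)
  also have "\<dots> \<subseteq> F <#> (F' <#> K)" using F'(3) by (rule mono_set_mult[OF order_refl])
  also have "\<dots> = (F <#> F') <#> K" by (simp add: set_mult_assoc F F' K)
  finally have "K #> (g \<otimes> h) \<subseteq> (F <#> F') <#> K" .
  moreover have "finite (F <#> F')" "F <#> F' \<subseteq> carrier G"
    using F F' by (auto simp: set_mult_def)
  ultimately show ?thesis unfolding coset_finite_def by blast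
qed

text \<open>For a single element the condition does not pass to the inverse: K \<inter> g K (inv g)
  may have finite index in \<open>K\<close> while the intersection for \<open>inv g\<close> does
  not. Hence \<open>X\<close> is taken closed under inverses.\<close>

lemma coset_finite_generate:
  assumes "subgroup K G" "X \<subseteq> carrier G" "\<And>x. x \<in> X \<Longrightarrow> inv x \<in> X"
    "\<And>x. x \<in> X \<Longrightarrow> coset_finite K x" "g \<in> generate G X"
  shows "coset_finite K g"
  using assms(5)
proof (induction rule: generate.induct)
  case one
  have "K #> \<one> \<subseteq> {\<one>} <#> K" using subgroup.subset[OF assms(1)] by (force simp: r_coset_def set_mult_def)
  then show ?case unfolding coset_finite_def by (intro exI[of _ "{\<one>}"]) auto
next
  case (eng h1 h2)
  then show ?case using coset_finite_mult assms generate_in_carrier by metis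
qed (use assms in auto)

text \<open>The cosets of \<open>K \<inter> conjugate_set G g K\<close> in \<open>K\<close> are at
  most as many as the elements of \<open>F\<close>: each \<open>k\<close> in \<open>K\<close> has
  \<open>inv k \<otimes> g\<close> in some \<open>f <# K\<close>, and two elements with the same
  \<open>f\<close> lie in the same coset.\<close>

lemma commensuratedI:
  assumes K: "subgroup K G" and fin: "\<And>g. g \<in> carrier G \<Longrightarrow> coset_finite K g"
  shows "commensurated G K"
  unfolding commensurated_def
proof (intro conjI ballI K)
  fix g assume g: "g \<in> carrier G"
  interpret K: subgroup K G by (rule K)
  define Q where "Q = K \<inter> conjugate_set G g K"
  interpret Q: subgroup Q G
    unfolding Q_def by (intro subgroups_Inter_pair K subgroup_conjugate_set g)
  obtain F where F: "finite F" "F \<subseteq> carrier G" "K #> g \<subseteq> F <#> K"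
    using fin[OF g] unfolding coset_finite_def by auto
  \<comment> \<open>One representative is chosen for each \<open>f\<close>. If there is no suitable
    \<open>k\<close>, the value is arbitrary; this is harmless, since the image of \<open>F\<close>
    only has to contain all the cosets.\<close>
  define c where "c f = Q #> (SOME k. k \<in> K \<and> inv k \<otimes> g \<in> f <# K)" for f
  have "Q #> k \<in> c ` F" if k: "k \<in> K" for k
  proof -
    have "inv k \<otimes> g \<in> F <#> K" using F(3) k by (auto simp: r_coset_def)
    then obtain f where f: "f \<in> F" "inv k \<otimes> g \<in> f <# K" by (auto simp: set_mult_def l_coset_def)
    define k' where "k' = (SOME k. k \<in> K \<and> inv k \<otimes> g \<in> f <# K)"
    have k': "k' \<in> K" "inv k' \<otimes> g \<in> f <# K"
      using someI[of "\<lambda>k. k \<in> K \<and> inv k \<otimes> g \<in> f <# K" k] k f unfolding k'_def by auto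
    obtain a b where a: "a \<in> K" "inv k \<otimes> g = f \<otimes> a" and b: "b \<in> K" "inv k' \<otimes> g = f \<otimes> b"
      using f(2) k'(2) by (auto simp: l_coset_def)
    have car: "k \<in> carrier G" "k' \<in> carrier G" "a \<in> carrier G" "b \<in> carrier G" "f \<in> carrier G"
      using k k' a b f F by auto
    have "inv k = f \<otimes> a \<otimes> inv g" "inv k' = f \<otimes> b \<otimes> inv g"
      using a(2) b(2) car g by (simp_all flip: a(2) b(2) add: m_assoc)
    \<comment> \<open>The common factor \<open>f\<close> cancels, which leaves a conjugate by
      \<open>g\<close> of an element of \<open>K\<close>.\<close>
    then have "k \<otimes> inv k' = inv (f \<otimes> a \<otimes> inv g) \<otimes> (f \<otimes> b \<otimes> inv g)" using car by (metis inv_inv)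
    also have "\<dots> = g \<otimes> (inv a \<otimes> (inv f \<otimes> f) \<otimes> b) \<otimes> inv g"
      using car g by (simp only: inv_mult_group m_assoc inv_inv inv_closed m_closed)
    also have "\<dots> = g \<otimes> (inv a \<otimes> b) \<otimes> inv g"
      using car g by simp
    finally have "k \<otimes> inv k' = g \<otimes> (inv a \<otimes> b) \<otimes> inv g" .
    moreover have "inv a \<otimes> b \<in> K" "k \<otimes> inv k' \<in> K" using k k'(1) a(1) b(1) by blast+
    ultimately have "k \<otimes> inv k' \<in> Q"
      unfolding Q_def conjugate_set_eq_image by blast
    moreover have "k = (k \<otimes> inv k') \<otimes> k'" using car by (simp add: m_assoc)
    ultimately have "k \<in> Q #> k'" unfolding r_coset_def by blast
    then have "Q #> k' = Q #> k" using car(2) Q.subgroup_axioms by (rule repr_independence)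
    then show ?thesis using f k'_def c_def by auto
  qed
  then have "rcosets\<^bsub>G\<lparr>carrier := K\<rparr>\<^esub> Q \<subseteq> c ` F"
    by (auto simp: RCOSETS_def r_coset_def)
  then show "finite (rcosets\<^bsub>G\<lparr>carrier := K\<rparr>\<^esub> (K \<inter> conjugate_set G g K))"
    using F(1) finite_surj unfolding Q_def by blast
qed

end

section \<open>Continuity of the group operations, open subgroups and their cosets\<close>

context topological_group
begin

lemma openin_subset_carrier: "openin T U \<Longrightarrow> U \<subseteq> carrier G"
  using openin_subset topspace_eq_carrier by metis

lemma continuous_map_mult:
  assumes "continuous_map X T f" "continuous_map X T h"
  shows "continuous_map X T (\<lambda>x. f x \<otimes> h x)"
proof -
  have "continuous_map X (prod_topology T T) (\<lambda>x. (f x, h x))"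
    using assms by (simp add: continuous_map_pairedI)
  then have "continuous_map X T ((\<lambda>(x, y). x \<otimes> y) \<circ> (\<lambda>x. (f x, h x)))"
    using continuous_mult by (rule continuous_map_compose)
  then show ?thesis by (simp add: o_def)
qed

lemma continuous_map_inv:
  assumes "continuous_map X T f"
  shows "continuous_map X T (\<lambda>x. inv (f x))"
  using continuous_map_compose[OF assms continuous_inv] by (simp add: o_def)

lemma continuous_map_const': "g \<in> carrier G \<Longrightarrow> continuous_map X T (\<lambda>_. g)"
  by (simp add: topspace_eq_carrier)

lemmas continuous_group_intros =
  continuous_map_mult continuous_map_inv continuous_map_const' continuous_map_id[unfolded id_def]
  continuous_map_fst continuous_map_snd

lemma openin_preimage:
  assumes "continuous_map T T f" "openin T U"
  shows "openin T {x \<in> carrier G. f x \<in> U}"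
  using openin_continuous_map_preimage[OF assms] by (simp add: topspace_eq_carrier)

lemma openin_l_coset:
  assumes "g \<in> carrier G" "openin T U"
  shows "openin T (g <# U)"
proof -
  have "g <# U = {x \<in> carrier G. inv g \<otimes> x \<in> U}"
  proof (intro Set.set_eqI iffI)
    fix x assume "x \<in> {x \<in> carrier G. inv g \<otimes> x \<in> U}"
    then have "inv g \<otimes> x \<in> U" "x = g \<otimes> (inv g \<otimes> x)"
      using assms by (auto simp flip: m_assoc)
    then show "x \<in> g <# U" by (force simp: l_coset_def)
  next
    fix x assume "x \<in> g <# U"
    then obtain u where "u \<in> U" "x = g \<otimes> u" by (auto simp: l_coset_def)
    moreover have "u \<in> carrier G" using calculation openin_subset_carrier[OF assms(2)] by auto
    ultimately show "x \<in> {x \<in> carrier G. inv g \<otimes> x \<in> U}"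
      using assms by (simp flip: m_assoc)
  qed
  moreover have "continuous_map T T (\<lambda>x. inv g \<otimes> x)"
    using assms by (intro continuous_group_intros) auto
  ultimately show ?thesis using openin_preimage assms by simp
qed

text \<open>The subgroup is the union of the translates \<open>s <# U\<close> of one neighbourhood
  of the identity.\<close>

lemma openin_subgroupI:
  assumes S: "subgroup S G" and U: "openin T U" "\<one> \<in> U" "U \<subseteq> S"
  shows "openin T S"
proof -
  interpret S: subgroup S G by (rule S)
  have "S = (\<Union>s\<in>S. s <# U)"
  proof
    show "S \<subseteq> (\<Union>s\<in>S. s <# U)" using mem_l_coset_self U S.subset by blast
    show "(\<Union>s\<in>S. s <# U) \<subseteq> S" using U by (auto simp: l_coset_def)
  qed
  moreover have "openin T (\<Union>s\<in>S. s <# U)"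
    using U S.subset by (intro openin_Union) (auto intro: openin_l_coset)
  ultimately show ?thesis by simp
qed

text \<open>The complement is a union of left cosets, each of which is open.\<close>

lemma closedin_open_subgroup:
  assumes S: "subgroup S G" and "openin T S"
  shows "closedin T S"
proof -
  interpret S: subgroup S G by (rule S)
  have "carrier G - S = (\<Union>g\<in>carrier G - S. g <# S)"
  proof
    show "carrier G - S \<subseteq> (\<Union>g\<in>carrier G - S. g <# S)"
      using mem_l_coset_self S.one_closed by blast
    show "(\<Union>g\<in>carrier G - S. g <# S) \<subseteq> carrier G - S"
    proof
      fix x assume "x \<in> (\<Union>g\<in>carrier G - S. g <# S)"
      then obtain g s where gs: "g \<in> carrier G" "g \<notin> S" "s \<in> S" "x = g \<otimes> s"
        by (auto simp: l_coset_def)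
      have "x \<notin> S"
      proof
        assume "x \<in> S"
        then have "x \<otimes> inv s \<in> S" using gs by auto
        then show False using gs by (simp add: m_assoc)
      qed
      then show "x \<in> carrier G - S" using gs by auto
    qed
  qed
  moreover have "openin T (\<Union>g\<in>carrier G - S. g <# S)"
    using assms by (intro openin_Union) (auto intro: openin_l_coset)
  ultimately show ?thesis using S.subset by (simp add: closedin_def topspace_eq_carrier)
qed

section \<open>Compact sets, coverings by cosets, and conjugates\<close>

text \<open>The translates \<open>d <# V\<close> form an open cover. The set \<open>D\<close> of
  representatives is independent of \<open>C\<close>, so that it can also be a dense
  subgroup.\<close>

lemma compactin_covered_by_cosets:
  assumes "compactin T C" "openin T V" "D \<subseteq> carrier G" "C \<subseteq> D <#> V"
  obtains F where "finite F" "F \<subseteq> D" "C \<subseteq> F <#> V"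
proof -
  have eq: "F <#> V = (\<Union>d\<in>F. d <# V)" for F by (auto simp: set_mult_def l_coset_def)
  have "\<exists>\<F>. finite \<F> \<and> \<F> \<subseteq> (\<lambda>d. d <# V) ` D \<and> C \<subseteq> \<Union>\<F>"
    by (rule compactinD[OF assms(1)]) (use assms openin_l_coset eq in auto)
  then obtain \<F> where \<F>: "finite \<F>" "\<F> \<subseteq> (\<lambda>d. d <# V) ` D" "C \<subseteq> \<Union>\<F>" by auto
  then obtain F where "F \<subseteq> D" "finite F" "\<F> = (\<lambda>d. d <# V) ` F"
    by (metis finite_subset_image)
  then show ?thesis using that[of F] \<F>(3) eq by auto
qed

text \<open>If the representatives are taken in \<open>C\<close>, then in c = f v the factor v =
  (inv f) c lies in \<open>C\<close> too, so \<open>V\<close> may be cut down to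
  \<open>C \<inter> V\<close>.\<close>

lemma compactin_covered_by_own_cosets:
  assumes "compactin T C" "subgroup C G" "openin T V" "\<one> \<in> V"
  obtains F where "finite F" "F \<subseteq> C" "C \<subseteq> F <#> (C \<inter> V)"
proof -
  interpret C: subgroup C G by fact
  have "C \<subseteq> C <#> V" using assms(4) C.subset by (rule subset_set_mult_one[rotated])
  then obtain F where F: "finite F" "F \<subseteq> C" "C \<subseteq> F <#> V"
    using compactin_covered_by_cosets[OF assms(1,3) C.subset] by blast
  have "C \<subseteq> F <#> (C \<inter> V)"
  proof
    fix c assume c: "c \<in> C"
    then obtain f v where fv: "f \<in> F" "v \<in> V" "c = f \<otimes> v" using F(3) by (auto simp: set_mult_def)
    have "v = inv f \<otimes> c" using fv F openin_subset_carrier[OF assms(3)] C.subset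
      by (simp add: inv_solve_left subset_iff)
    moreover have "inv f \<otimes> c \<in> C" using c fv(1) F(2) by blast
    ultimately have "v \<in> C" by metis
    then show "c \<in> F <#> (C \<inter> V)" using fv by (auto simp: set_mult_def)
  qed
  then show ?thesis using that F by blast
qed

lemma compactin_set_mult:
  assumes "compactin T A" "compactin T B"
  shows "compactin T (A <#> B)"
proof -
  have "A <#> B = (\<lambda>(x, y). x \<otimes> y) ` (A \<times> B)" by (auto simp: set_mult_def)
  moreover have "compactin (prod_topology T T) (A \<times> B)" using assms by (simp add: compactin_Times)
  ultimately show ?thesis using image_compactin continuous_mult by metis
qed

lemma continuous_map_conjugation: "g \<in> carrier G \<Longrightarrow> continuous_map T T (\<lambda>x. g \<otimes> x \<otimes> inv g)"
  by (intro continuous_group_intros) auto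

lemma compactin_conjugate_set:
  "\<lbrakk>g \<in> carrier G; compactin T H\<rbrakk> \<Longrightarrow> compactin T (conjugate_set G g H)"
  unfolding conjugate_set_eq_image using image_compactin continuous_map_conjugation by blast

lemma locally_normal_conjugate_set:
  assumes g: "g \<in> carrier G" and H: "locally_normal G T H"
  shows "locally_normal G T (conjugate_set G g H)"
proof -
  have sub: "subgroup H G" "openin T (normalizer G H)" using H by (auto simp: locally_normal_def)
  have "continuous_map T T (\<lambda>x. inv g \<otimes> x \<otimes> g)" using g by (intro continuous_group_intros) auto
  then have "openin T (normalizer G (conjugate_set G g H))"
    unfolding normalizer_conjugate_set[OF g subgroup.subset[OF sub(1)]]
    using openin_preimage sub(2) by blast
  then show ?thesis using subgroup_conjugate_set g sub by (simp add: locally_normal_def)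
qed

section \<open>Closures of subgroups\<close>

lemma subgroup_closure_of:
  assumes N: "subgroup N G"
  shows "subgroup (T closure_of N) G"
proof -
  interpret N: subgroup N G by (rule N)
  let ?C = "T closure_of N"
  have NC: "N \<subseteq> ?C" using closure_of_subset N.subset topspace_eq_carrier by metis
  have Cc: "?C \<subseteq> carrier G" using closure_of_subset_topspace topspace_eq_carrier by metis
  \<comment> \<open>A continuous self-map that sends \<open>N\<close> into the closure sends the
    whole closure into it. This treats multiplication one variable at a time: first the left factor
    is reduced to \<open>N\<close>, then the right one.\<close>
  have step: "f x \<in> ?C" if "continuous_map T T f" "\<And>n. n \<in> N \<Longrightarrow> f n \<in> ?C" "x \<in> ?C" for f x
  proof -
    have "f ` ?C \<subseteq> T closure_of (f ` N)" using that(1) by (rule continuous_map_image_closure_subset)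
    also have "\<dots> \<subseteq> T closure_of ?C" by (rule closure_of_mono) (use that(2) in auto)
    finally show ?thesis using that(3) by auto
  qed
  show ?thesis
  proof (rule subgroupI[OF Cc])
    show "?C \<noteq> {}" using NC N.one_closed by blast
    show "inv a \<in> ?C" if "a \<in> ?C" for a
      by (rule step[OF continuous_inv _ that]) (use NC in auto)
    show "a \<otimes> b \<in> ?C" if ab: "a \<in> ?C" "b \<in> ?C" for a b
    proof (rule step[of "\<lambda>x. x \<otimes> b", OF _ _ ab(1)])
      show "continuous_map T T (\<lambda>x. x \<otimes> b)" using ab Cc by (intro continuous_group_intros) auto
      fix n assume n: "n \<in> N"
      show "n \<otimes> b \<in> ?C"
      proof (rule step[OF _ _ ab(2)])
        show "continuous_map T T ((\<otimes>) n)" using n by (intro continuous_group_intros) auto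
      qed (use n NC in auto)
    qed
  qed
qed

lemma normal_closure_of:
  assumes N: "N \<lhd> G"
  shows "T closure_of N \<lhd> G"
proof -
  have "g \<otimes> x \<otimes> inv g \<in> T closure_of N" if g: "g \<in> carrier G" and x: "x \<in> T closure_of N" for g x
  proof -
    have "(\<lambda>x. g \<otimes> x \<otimes> inv g) ` (T closure_of N) \<subseteq> T closure_of ((\<lambda>x. g \<otimes> x \<otimes> inv g) ` N)"
      using continuous_map_conjugation[OF g] by (rule continuous_map_image_closure_subset)
    also have "\<dots> \<subseteq> T closure_of N"
      by (rule closure_of_mono) (use N g in \<open>auto simp: normal_inv_iff\<close>)
    finally show ?thesis using x by auto
  qed
  then show ?thesis
    using N subgroup_closure_of by (auto simp: normal_inv_iff)
qed

section \<open>Totally disconnected groups: separation and compact open subgroups\<close>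

text \<open>The closure of the trivial subgroup is connected, hence trivial. The diagonal is then
  closed as the preimage of the identity under (x, y) \<mapsto> x (inv y).\<close>

lemma Hausdorff_if_totally_disconnected:
  assumes "totally_disconnected_space T"
  shows "Hausdorff_space T"
proof -
  have one: "\<one> \<in> topspace T" by (simp add: topspace_eq_carrier)
  have "connectedin T (T closure_of {\<one>})" using one by (intro connectedin_closure_of) simp
  moreover have "\<one> \<in> T closure_of {\<one>}" using one closure_of_subset[of "{\<one>}" T] by simp
  ultimately have "T closure_of {\<one>} \<subseteq> connected_component_of_set T \<one>"
    by (rule connected_component_of_maximal)
  then have "T closure_of {\<one>} \<subseteq> {\<one>}" using assms one by (simp add: totally_disconnected_space_def)
  then have closed: "closedin T {\<one>}" using one by (metis closure_of_subset_eq empty_subsetI insert_subset)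
  have "continuous_map (prod_topology T T) T (\<lambda>z. fst z \<otimes> inv (snd z))"
    by (intro continuous_group_intros)
  then have "closedin (prod_topology T T) {z \<in> topspace (prod_topology T T). fst z \<otimes> inv (snd z) \<in> {\<one>}}"
    using closed by (rule closedin_continuous_map_preimage)
  also have "{z \<in> topspace (prod_topology T T). fst z \<otimes> inv (snd z) \<in> {\<one>}} = (\<lambda>x. (x, x)) ` topspace T"
    by (auto simp: topspace_eq_carrier dest: inv_equality)
  finally show ?thesis by (simp add: Hausdorff_space_closedin_diagonal)
qed

text \<open>This is van Dantzig's theorem. A compact open neighbourhood \<open>A\<close> of the
  identity inside \<open>W\<close> is found first; the elements that preserve \<open>A\<close> under
  left translation, together with their inverses, form the subgroup.\<close>

lemma compact_open_subgroup_exists: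
  assumes "locally_compact_space T" and td: "totally_disconnected_space T"
    and W: "openin T W" "\<one> \<in> W"
  obtains U where "subgroup U G" "openin T U" "compactin T U" "U \<subseteq> W"
proof -
  have Hd: "Hausdorff_space T" by (rule Hausdorff_if_totally_disconnected[OF td])
  have one: "\<one> \<in> topspace T" by (simp add: topspace_eq_carrier)
  obtain B C where B: "openin T B" "compactin T C" "\<one> \<in> B" "B \<subseteq> C"
    using assms(1) one unfolding locally_compact_space_def by blast
  have "{\<one>} \<in> connected_components_of T"
    using td one unfolding totally_disconnected_space_def connected_components_of_def by force
  moreover have "compactin T {\<one>}" "openin T (B \<inter> W)" "{\<one>} \<subseteq> B \<inter> W" using B W one by auto
  \<comment> \<open>The component of the identity is a point, so it can be separated from the
    complement of \<open>B \<inter> W\<close> by a clopen set; \<open>B\<close> is there to make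
    that set compact.\<close>
  ultimately obtain A A' where A: "openin T A" "openin T A'" "disjnt A A'" "A \<union> A' = topspace T"
    "\<one> \<in> A" "A \<subseteq> B \<inter> W"
    using wilder_locally_compact_component_thm[OF assms(1) Hd] by (metis insert_subset)
  have Ac: "A \<subseteq> carrier G" by (rule openin_subset_carrier[OF A(1)])
  have "topspace T - A = A'" using A by (auto simp: disjnt_def)
  then have clA: "closedin T A" using A Ac by (simp add: closedin_def topspace_eq_carrier)
  then have cA: "compactin T A" using B A by (meson closed_compactin le_infE subset_trans)
  define P where "P = {z \<in> topspace (prod_topology T T). fst z \<otimes> snd z \<in> A}"
  have "openin (prod_topology T T) P"
    unfolding P_def using A(1)
    by (intro openin_continuous_map_preimage[of _ T]) (intro continuous_group_intros)
  moreover have "{\<one>} \<times> A \<subseteq> P" using Ac by (auto simp: P_def topspace_eq_carrier)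
  \<comment> \<open>Compactness of \<open>A\<close> gives, by the tube lemma, a single neighbourhood
    \<open>Q\<close> of the identity that works for all points of \<open>A\<close>: Q A \<subseteq>
    A.\<close>
  ultimately obtain Q R where Q: "openin T Q" "\<one> \<in> Q" "A \<subseteq> R" "Q \<times> R \<subseteq> P"
    using tube_lemma_right[OF _ cA one] by metis
  have QA: "q \<otimes> a \<in> A" if "q \<in> Q" "a \<in> A" for q a
    using that Q unfolding P_def by fastforce
  define S where "S = {g \<in> carrier G. \<forall>a\<in>A. g \<otimes> a \<in> A \<and> inv g \<otimes> a \<in> A}"
  have S: "subgroup S G"
  proof (rule subgroupI)
    show "S \<noteq> {}" using Ac by (auto simp: S_def intro!: exI[of _ \<one>])
    show "g \<otimes> h \<in> S" if "g \<in> S" "h \<in> S" for g h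
      using that Ac by (auto simp: S_def inv_mult_group m_assoc subset_iff)
  qed (auto simp: S_def)
  have "openin T (Q \<inter> {x \<in> carrier G. inv x \<in> Q})"
    using Q(1) continuous_inv by (intro openin_Int openin_preimage)
  moreover have "\<one> \<in> Q \<inter> {x \<in> carrier G. inv x \<in> Q}" using Q by simp
  moreover have "Q \<inter> {x \<in> carrier G. inv x \<in> Q} \<subseteq> S" by (auto simp: S_def QA)
  ultimately have So: "openin T S" by (rule openin_subgroupI[OF S])
  \<comment> \<open>Since \<open>A\<close> contains the identity, g = g \<one> lies in
    \<open>A\<close> for every \<open>g\<close> in \<open>S\<close>.\<close>
  have SA: "S \<subseteq> A" using A(5) by (force simp: S_def)
  have "compactin T S" using closed_compactin[OF cA SA closedin_open_subgroup[OF S So]] .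
  then show ?thesis using that S So SA A(6) by blast
qed

section \<open>Finite families of conjugates of a locally normal subgroup\<close>

text \<open>The conjugate by \<open>g\<close> depends only on the coset of \<open>g\<close> modulo
  the normaliser of \<open>L\<close>. The normaliser is open, so finitely many of its cosets cover
  \<open>C\<close>.\<close>

lemma finite_conjugates_by_compact:
  assumes "compactin T C" "locally_normal G T L"
  shows "finite ((\<lambda>g. conjugate_set G g L) ` C)"
proof -
  have L: "subgroup L G" "openin T (normalizer G L)" using assms(2) by (auto simp: locally_normal_def)
  have Lc: "L \<subseteq> carrier G" by (rule subgroup.subset[OF L(1)])
  have Cc: "C \<subseteq> carrier G" using compactin_subset_topspace[OF assms(1)] topspace_eq_carrier by simp
  have "\<one> \<in> normalizer G L" by (simp add: mem_normalizer_iff Lc conjugate_set_one)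
  then have "C \<subseteq> C <#> normalizer G L" by (rule subset_set_mult_one[OF Cc])
  then obtain F where F: "finite F" "F \<subseteq> C" "C \<subseteq> F <#> normalizer G L"
    using compactin_covered_by_cosets[OF assms(1) L(2) Cc] by metis
  have "conjugate_set G c L \<in> (\<lambda>g. conjugate_set G g L) ` F" if "c \<in> C" for c
  proof -
    have "c \<in> F <#> normalizer G L" using that F(3) by blast
    then obtain f n where fn: "f \<in> F" "n \<in> normalizer G L" "c = f \<otimes> n"
      unfolding set_mult_def by blast
    then have "conjugate_set G c L = conjugate_set G f L"
      using F(2) Cc Lc by (auto simp: mem_normalizer_iff conjugate_set_mult)
    then show ?thesis using fn by blast
  qed
  then show ?thesis using F(1) finite_subset by (meson finite_imageI image_subsetI)
qed

text \<open>All \<open>U\<close>-conjugates of the members of \<open>\<L>0\<close> are adjoined; as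
  \<open>U\<close> is compact, the family stays finite.\<close>

lemma finite_invariant_conjugates:
  assumes U: "subgroup U G" "compactin T U" and H: "locally_normal G T H"
    and \<L>0: "finite \<L>0" "\<L>0 \<subseteq> (\<lambda>g. conjugate_set G g H) ` carrier G"
  obtains \<L> where "finite \<L>" "\<L>0 \<subseteq> \<L>" "\<L> \<subseteq> (\<lambda>g. conjugate_set G g H) ` carrier G"
    "\<And>u L. \<lbrakk>u \<in> U; L \<in> \<L>\<rbrakk> \<Longrightarrow> conjugate_set G u L \<in> \<L>"
proof
  interpret U: subgroup U G by (rule U(1))
  have Hc: "H \<subseteq> carrier G" using H subgroup.subset unfolding locally_normal_def by blast
  have lnL: "locally_normal G T L" if "L \<in> \<L>0" for L
    using that \<L>0(2) locally_normal_conjugate_set[OF _ H] by blast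
  then have Lc: "L \<subseteq> carrier G" if "L \<in> \<L>0" for L
    using that subgroup.subset unfolding locally_normal_def by blast
  let ?\<L> = "\<Union>L\<in>\<L>0. (\<lambda>u. conjugate_set G u L) ` U"
  show "finite ?\<L>" using \<L>0(1) finite_conjugates_by_compact[OF U(2) lnL] by auto
  show "\<L>0 \<subseteq> ?\<L>"
  proof
    fix L assume "L \<in> \<L>0"
    moreover then have "L = conjugate_set G \<one> L" using Lc conjugate_set_one by simp
    ultimately show "L \<in> ?\<L>" using U.one_closed by blast
  qed
  show "?\<L> \<subseteq> (\<lambda>g. conjugate_set G g H) ` carrier G"
  proof
    fix M assume "M \<in> ?\<L>"
    then obtain L u where "L \<in> \<L>0" "u \<in> U" "M = conjugate_set G u L" by auto
    moreover then obtain g where "g \<in> carrier G" "L = conjugate_set G g H" using \<L>0(2) by auto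
    ultimately have "u \<otimes> g \<in> carrier G" "M = conjugate_set G (u \<otimes> g) H"
      using conjugate_set_mult Hc by auto
    then show "M \<in> (\<lambda>g. conjugate_set G g H) ` carrier G" by blast
  qed
  fix u M assume u: "u \<in> U" and "M \<in> ?\<L>"
  then obtain L v where L: "L \<in> \<L>0" "v \<in> U" "M = conjugate_set G v L" by auto
  then have "conjugate_set G u M = conjugate_set G (u \<otimes> v) L" using conjugate_set_mult Lc u by auto
  then show "conjugate_set G u M \<in> ?\<L>" using L u by blast
qed

text \<open>The normal closure \<open>N\<close> of \<open>H\<close> is dense, so N V contains a
  compact generating set \<open>C\<close>, and finitely many elements of \<open>N\<close> already
  give \<open>C\<close> modulo \<open>V\<close>. The lemma serves twice: for a compact open
  subgroup, and for the commensurated subgroup once it is known to be open.\<close>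

lemma generate_open_subgroup_Un_conjugates:
  assumes cg: "compactly_generated_group G T" and simple: "topologically_simple G T"
    and H: "subgroup H G" "H \<noteq> {\<one>}" and V: "subgroup V G" "openin T V"
  obtains \<L> where "finite \<L>" "\<L> \<subseteq> (\<lambda>g. conjugate_set G g H) ` carrier G"
    "generate G (V \<union> \<Union>\<L>) = carrier G"
proof -
  interpret V: subgroup V G by (rule V(1))
  let ?\<C> = "(\<lambda>g. conjugate_set G g H) ` carrier G"
  define N where "N = generate G (\<Union>?\<C>)"
  have Hc: "H \<subseteq> carrier G" by (rule subgroup.subset[OF H(1)])
  have Cc: "\<Union>?\<C> \<subseteq> carrier G" using conjugate_set_subset_carrier[OF _ Hc] by blast
  have N: "N \<lhd> G" unfolding N_def by (rule generate_Union_conjugation_normal[OF Hc])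
  have Nc: "N \<subseteq> carrier G" unfolding N_def by (rule generate_incl[OF Cc])
  have "H \<subseteq> N" unfolding N_def
    using generate.incl[of _ "\<Union>?\<C>" G] conjugate_set_one[OF Hc] by blast
  moreover have "\<one> \<in> H" by (rule subgroup.one_closed[OF H(1)])
  moreover have "N \<subseteq> T closure_of N"
    using closure_of_subset[of N T] Nc topspace_eq_carrier by simp
  ultimately have "T closure_of N \<noteq> {\<one>}" using H(2) by blast
  then have dense: "T closure_of N = carrier G"
    using simple normal_closure_of[OF N] closedin_closure_of[of T N]
    unfolding topologically_simple_def by metis
  obtain C where C: "compactin T C" "generate G C = carrier G"
    using cg unfolding compactly_generated_group_def by blast
  have Cc': "C \<subseteq> carrier G" using compactin_subset_topspace[OF C(1)] topspace_eq_carrier by simp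
  have "C \<subseteq> N <#> V"
  proof
    fix c assume "c \<in> C"
    then have c: "c \<in> carrier G" using Cc' by blast
    \<comment> \<open>The neighbourhood \<open>c <# V\<close> of \<open>c\<close> meets the dense
      subgroup \<open>N\<close>.\<close>
    have "openin T (c <# V)" "c \<in> c <# V"
      using openin_l_coset[OF c V(2)] mem_l_coset_self[OF c V.one_closed] by auto
    then obtain n where n: "n \<in> N" "n \<in> c <# V" using c dense in_closure_of[of c T N] by blast
    then obtain v where v: "v \<in> V" "n = c \<otimes> v" unfolding l_coset_def by blast
    then have "c = n \<otimes> inv v" using c by (simp add: m_assoc)
    then show "c \<in> N <#> V" using n v V.m_inv_closed unfolding set_mult_def by blast
  qed
  then obtain F where F: "finite F" "F \<subseteq> N" "C \<subseteq> F <#> V"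
    using compactin_covered_by_cosets[OF C(1) V(2) Nc] by metis
  obtain \<L> where \<L>: "finite \<L>" "\<L> \<subseteq> ?\<C>" "F \<subseteq> generate G (\<Union>\<L>)"
    using finite_subset_generate_Union[OF F(1)] F(2) unfolding N_def by metis
  let ?X = "V \<union> \<Union>\<L>"
  have "F \<subseteq> generate G ?X" using \<L>(3) mono_generate[of "\<Union>\<L>" ?X] by blast
  then have "C \<subseteq> generate G ?X"
    using F(3) generate.incl[of _ ?X G] generate.eng[of _ G ?X] unfolding set_mult_def by blast
  moreover have "?X \<subseteq> carrier G" using V.subset \<L>(2) Cc by blast
  ultimately have "generate G ?X = carrier G" using generate_eqI[OF C(2)] by blast
  then show ?thesis using that \<L> by blast
qed

section \<open>Compactness of finite products of subgroups normalising one another\<close>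

text \<open>The subgroup \<open>P\<close> generated by the earlier members lies in \<open>V\<close>,
  hence normalises the new member \<open>M\<close>. So \<open>M <#> P\<close> is already the
  generated subgroup, and it is compact as a product of two compact sets.\<close>

lemma compactin_generate_Union_normalized:
  assumes V: "subgroup V G" and "finite \<M>"
    and "\<And>M. M \<in> \<M> \<Longrightarrow> compactin T M \<and> subgroup M G \<and> M \<subseteq> V"
    and "\<And>M v m. \<lbrakk>M \<in> \<M>; v \<in> V; m \<in> M\<rbrakk> \<Longrightarrow> v \<otimes> m \<otimes> inv v \<in> M"
  shows "compactin T (generate G (\<Union>\<M>))"
  using assms(2-)
proof (induction \<M>)
  case empty
  then show ?case by (simp add: generate_empty topspace_eq_carrier)
next
  case (insert M \<M>)
  interpret V: subgroup V G by (rule V)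
  interpret M: subgroup M G using insert.prems by blast
  define P where "P = generate G (\<Union>\<M>)"
  have uV: "\<Union>\<M> \<subseteq> V" using insert.prems by blast
  have PV: "P \<subseteq> V" unfolding P_def by (rule generate_subgroup_incl[OF uV V])
  interpret P: subgroup P G unfolding P_def using uV V.subset by (intro generate_is_subgroup) blast
  have norm: "v \<otimes> m \<otimes> inv v \<in> M" if "v \<in> V" "m \<in> M" for v m using insert.prems(2) that by blast
  have MP: "subgroup (M <#> P) G"
  proof (rule subgroupI)
    show "M <#> P \<subseteq> carrier G" using M.subset P.subset by (rule set_mult_closed)
    show "M <#> P \<noteq> {}" using M.one_closed P.one_closed unfolding set_mult_def by blast
    fix a assume "a \<in> M <#> P"
    then obtain m p where a: "m \<in> M" "p \<in> P" "a = m \<otimes> p" unfolding set_mult_def by blast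
    have "inv a = (inv p \<otimes> inv m \<otimes> inv (inv p)) \<otimes> inv p" using a by (simp add: inv_mult_group m_assoc)
    moreover have "inv p \<otimes> inv m \<otimes> inv (inv p) \<in> M" using a PV by (intro norm) auto
    ultimately show "inv a \<in> M <#> P" using a P.m_inv_closed unfolding set_mult_def by blast
    fix b assume "b \<in> M <#> P"
    then obtain m' p' where b: "m' \<in> M" "p' \<in> P" "b = m' \<otimes> p'" unfolding set_mult_def by blast
    \<comment> \<open>Inserting (inv p) p after m' moves \<open>p\<close> past m' at the cost of
      conjugating m' inside \<open>M\<close>.\<close>
    have "a \<otimes> b = m \<otimes> (p \<otimes> m' \<otimes> (inv p \<otimes> p)) \<otimes> p'" using a b by (simp add: m_assoc)
    also have "\<dots> = (m \<otimes> (p \<otimes> m' \<otimes> inv p)) \<otimes> (p \<otimes> p')"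
      using a(1,2) b(1,2) by (simp only: m_assoc M.mem_carrier P.mem_carrier inv_closed m_closed)
    finally have "a \<otimes> b = (m \<otimes> (p \<otimes> m' \<otimes> inv p)) \<otimes> (p \<otimes> p')" .
    moreover have "m \<otimes> (p \<otimes> m' \<otimes> inv p) \<in> M" using a b PV norm by blast
    moreover have "p \<otimes> p' \<in> P" using a b by blast
    ultimately show "a \<otimes> b \<in> M <#> P" unfolding set_mult_def by blast
  qed
  have "generate G (\<Union>(insert M \<M>)) = M <#> P"
  proof
    have "M \<subseteq> M <#> P" using subset_set_mult_one[OF M.subset P.one_closed] .
    moreover have "P \<subseteq> M <#> P"
    proof
      fix p assume "p \<in> P"
      moreover then have "p = \<one> \<otimes> p" by simp
      ultimately show "p \<in> M <#> P" using M.one_closed unfolding set_mult_def by blast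
    qed
    moreover have "\<Union>\<M> \<subseteq> P" unfolding P_def by (auto intro: generate.incl)
    ultimately show "generate G (\<Union>(insert M \<M>)) \<subseteq> M <#> P"
      by (intro generate_subgroup_incl MP) auto
    have "M \<subseteq> generate G (\<Union>(insert M \<M>))" using generate.incl[of _ "\<Union>(insert M \<M>)" G] by blast
    moreover have "P \<subseteq> generate G (\<Union>(insert M \<M>))" unfolding P_def by (rule mono_generate) auto
    ultimately show "M <#> P \<subseteq> generate G (\<Union>(insert M \<M>))"
      using generate.eng[of _ G "\<Union>(insert M \<M>)"] unfolding set_mult_def by blast
  qed
  moreover have "compactin T P" unfolding P_def by (rule insert.IH) (use insert.prems in blast)+
  moreover have "compactin T M" using insert.prems(1) by blast
  ultimately show ?case using compactin_set_mult by metis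
qed

section \<open>Excluding finite locally normal subgroups\<close>

text \<open>For \<open>g\<close> near the identity, the conjugate of \<open>x\<close> by
  \<open>g\<close> stays in \<open>L\<close> and, by continuity, avoids the finite closed set
  \<open>L - {x}\<close>; so it equals \<open>x\<close>.\<close>

lemma openin_centralizer_finite_locally_normal:
  assumes Hd: "Hausdorff_space T" and L: "locally_normal G T L" "finite L" and x: "x \<in> L"
  shows "openin T {g \<in> carrier G. g \<otimes> x = x \<otimes> g}"
proof (rule openin_subgroupI)
  have sub: "subgroup L G" "openin T (normalizer G L)" using L(1) by (auto simp: locally_normal_def)
  have Lc: "L \<subseteq> carrier G" by (rule subgroup.subset[OF sub(1)])
  have xc: "x \<in> carrier G" using x Lc by blast
  show "subgroup {g \<in> carrier G. g \<otimes> x = x \<otimes> g} G"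
  proof (rule subgroupI)
    show "{g \<in> carrier G. g \<otimes> x = x \<otimes> g} \<noteq> {}" using xc by (auto intro!: exI[of _ \<one>])
    fix g assume "g \<in> {g \<in> carrier G. g \<otimes> x = x \<otimes> g}"
    then have g: "g \<in> carrier G" "g \<otimes> x = x \<otimes> g" by auto
    have "inv g \<otimes> x = inv g \<otimes> (x \<otimes> g) \<otimes> inv g" using g(1) xc by (simp add: m_assoc)
    also have "\<dots> = inv g \<otimes> (g \<otimes> x) \<otimes> inv g" using g(2) by simp
    also have "\<dots> = x \<otimes> inv g" using g(1) xc by (simp flip: m_assoc)
    finally show "inv g \<in> {g \<in> carrier G. g \<otimes> x = x \<otimes> g}" using g by simp
    fix h assume "h \<in> {g \<in> carrier G. g \<otimes> x = x \<otimes> g}"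
    then show "g \<otimes> h \<in> {g \<in> carrier G. g \<otimes> x = x \<otimes> g}" using g xc by simp (metis m_assoc)
  qed auto
  let ?O = "normalizer G L \<inter> {g \<in> carrier G. g \<otimes> x \<otimes> inv g \<in> carrier G - (L - {x})}"
  have "closedin T (L - {x})"
    using L(2) Lc by (intro closedin_Hausdorff_finite[OF Hd]) (auto simp: topspace_eq_carrier)
  then have "openin T (carrier G - (L - {x}))" using topspace_eq_carrier by (metis openin_diff openin_topspace)
  moreover have "continuous_map T T (\<lambda>g. g \<otimes> x \<otimes> inv g)" using xc by (intro continuous_group_intros)
  ultimately show "openin T ?O" using openin_preimage sub(2) by blast
  show "\<one> \<in> ?O" using xc x by (simp add: mem_normalizer_iff Lc conjugate_set_one)
  show "?O \<subseteq> {g \<in> carrier G. g \<otimes> x = x \<otimes> g}"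
  proof
    fix g assume g: "g \<in> ?O"
    then have "g \<otimes> x \<otimes> inv g \<in> L" using x by (auto simp: mem_normalizer_iff Lc conjugate_set_eq_image)
    then have eq: "g \<otimes> x \<otimes> inv g = x" using g by auto
    have gc: "g \<in> carrier G" using g by auto
    have "g \<otimes> x = (g \<otimes> x \<otimes> inv g) \<otimes> g" using gc xc by (simp add: m_assoc)
    then show "g \<in> {g \<in> carrier G. g \<otimes> x = x \<otimes> g}" using gc by (simp only: eq mem_Collect_eq)
  qed
qed

text \<open>The elements of \<open>U\<close> centralising every member of \<open>\<L>\<close> form an open subgroup that is
  normalised by \<open>U\<close> and centralised by \<open>\<Union>\<L>\<close>, hence would be a proper non-trivial closed
  normal subgroup of \<open>G\<close>.\<close>

lemma generate_Un_finite_locally_normal_ne_carrier: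
  assumes Hd: "Hausdorff_space T" and simple: "topologically_simple G T"
    and nd: "T \<noteq> discrete_topology (carrier G)"
    and U: "subgroup U G" "openin T U" "U \<noteq> carrier G"
    and \<L>: "finite \<L>" "\<And>L. L \<in> \<L> \<Longrightarrow> locally_normal G T L \<and> finite L"
    and inv: "\<And>u L. \<lbrakk>u \<in> U; L \<in> \<L>\<rbrakk> \<Longrightarrow> conjugate_set G u L \<in> \<L>"
  shows "generate G (U \<union> \<Union>\<L>) \<noteq> carrier G"
proof
  assume gen: "generate G (U \<union> \<Union>\<L>) = carrier G"
  interpret U: subgroup U G by (rule U(1))
  have sub: "subgroup L G" if "L \<in> \<L>" for L using \<L>(2)[OF that] by (simp add: locally_normal_def)
  have Lc: "L \<subseteq> carrier G" if "L \<in> \<L>" for L using subgroup.subset[OF sub[OF that]] .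
  let ?X = "\<Union>\<L>"
  let ?Z = "\<lambda>x. {g \<in> carrier G. g \<otimes> x = x \<otimes> g}"
  have Xc: "?X \<subseteq> carrier G" using Lc by blast
  define W where "W = {g \<in> U. \<forall>x\<in>?X. g \<otimes> x = x \<otimes> g}"
  have WU: "W \<subseteq> U" by (auto simp: W_def)
  have "W = U \<inter> ((\<Inter>x\<in>?X. ?Z x) \<inter> topspace T)" by (auto simp: W_def topspace_eq_carrier)
  moreover have "openin T ((\<Inter>x\<in>?X. ?Z x) \<inter> topspace T)"
    using \<L> by (intro openin_INT) (auto intro: openin_centralizer_finite_locally_normal[OF Hd])
  ultimately have Wo: "openin T W" using U(2) by auto
  have W: "subgroup W G"
  proof (rule subgroupI)
    show "W \<subseteq> carrier G" using WU U.subset by blast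
    show "W \<noteq> {}" using Xc by (auto simp: W_def subset_iff intro!: exI[of _ \<one>])
    fix g assume g: "g \<in> W"
    then have gU: "g \<in> U" and gc: "g \<in> carrier G" using WU by auto
    have "inv g \<otimes> x = x \<otimes> inv g" if x: "x \<in> ?X" for x
    proof -
      have xc: "x \<in> carrier G" using x Xc by blast
      have "inv g \<otimes> x = inv g \<otimes> (x \<otimes> g) \<otimes> inv g" using gc xc by (simp add: m_assoc)
      also have "x \<otimes> g = g \<otimes> x" using g x unfolding W_def by auto
      also have "inv g \<otimes> (g \<otimes> x) \<otimes> inv g = x \<otimes> inv g" using gc xc by (simp flip: m_assoc)
      finally show ?thesis .
    qed
    then show "inv g \<in> W" using U.m_inv_closed[OF gU] unfolding W_def by blast
    fix h assume h: "h \<in> W"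
    have "g \<otimes> h \<otimes> x = x \<otimes> (g \<otimes> h)" if x: "x \<in> ?X" for x
    proof -
      have xc: "x \<in> carrier G" and hc: "h \<in> carrier G" using x Xc h WU by auto
      have gx: "g \<otimes> x = x \<otimes> g" and hx: "h \<otimes> x = x \<otimes> h" using g h x unfolding W_def by blast+
      have "g \<otimes> h \<otimes> x = g \<otimes> x \<otimes> h" using gc hc xc by (simp add: m_assoc hx)
      also have "\<dots> = x \<otimes> (g \<otimes> h)" using gc hc xc by (simp add: m_assoc gx)
      finally show ?thesis .
    qed
    then show "g \<otimes> h \<in> W" using U.m_closed[of g h] g h unfolding W_def by blast
  qed
  have Wc: "W \<subseteq> carrier G" by (rule subgroup.subset[OF W])
  have step: "conjugate_set G g W \<subseteq> W" if g: "g \<in> U \<union> ?X" for g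
  proof
    fix y assume "y \<in> conjugate_set G g W"
    then obtain w where w: "w \<in> W" "y = g \<otimes> w \<otimes> inv g" by (auto simp: conjugate_set_eq_image)
    have wc: "w \<in> carrier G" using w Wc by blast
    have gc: "g \<in> carrier G" using g U.subset Xc by blast
    show "y \<in> W"
    proof (cases "g \<in> ?X")
      case True
      then have "w \<otimes> g = g \<otimes> w" using w(1) unfolding W_def by blast
      then have "y = w \<otimes> g \<otimes> inv g" using w(2) by simp
      then show ?thesis using w(1) wc gc by (simp add: m_assoc)
    next
      case False
      then have gU: "g \<in> U" using g by blast
      have "y \<otimes> x = x \<otimes> y" if x: "x \<in> ?X" for x
      proof -
        have xc: "x \<in> carrier G" using x Xc by blast
        obtain L where L: "L \<in> \<L>" "x \<in> L" using x by blast
        \<comment> \<open>Conjugation by \<open>inv g\<close> maps \<L> to itself, so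
          \<open>?x\<close> lies in the union again and commutes with \<open>w\<close>. Conjugating
          back, \<open>y\<close> commutes with \<open>x\<close>.\<close>
        let ?x = "inv g \<otimes> x \<otimes> g"
        have "?x \<in> conjugate_set G (inv g) L" using L gc by (auto simp: conjugate_set_eq_image)
        then have "?x \<in> ?X" using inv[OF U.m_inv_closed[OF gU] L(1)] by blast
        then have "w \<otimes> ?x = ?x \<otimes> w" using w(1) unfolding W_def by blast
        have "y \<otimes> x = g \<otimes> (w \<otimes> ?x) \<otimes> inv g" using w(2) wc gc xc by (simp add: m_assoc)
        also have "\<dots> = g \<otimes> (?x \<otimes> w) \<otimes> inv g" using \<open>w \<otimes> ?x = ?x \<otimes> w\<close> by simp
        also have "\<dots> = (g \<otimes> inv g) \<otimes> x \<otimes> (g \<otimes> w \<otimes> inv g)"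
          using wc gc xc by (simp only: m_assoc inv_closed m_closed)
        also have "\<dots> = x \<otimes> y" using w(2) wc gc xc by simp
        finally show ?thesis .
      qed
      moreover have "y \<in> U" using w WU gU by blast
      ultimately show ?thesis unfolding W_def by blast
    qed
  qed
  have "conjugate_set G g W \<subseteq> W" if "g \<in> generate G (U \<union> ?X)" for g
    using that
  proof (induction rule: generate.induct)
    case one
    then show ?case using conjugate_set_one[OF Wc] by simp
  next
    case (inv h)
    \<comment> \<open>The generating set is closed under inverses, so inclusions for its elements
      suffice and no equality has to be carried through the induction.\<close>
    then have "inv h \<in> U \<union> ?X" using sub subgroup.m_inv_closed by fastforce
    then show ?case by (rule step)
  next
    case (eng h1 h2)
    then have "h1 \<in> carrier G" "h2 \<in> carrier G" using gen by auto
    then have "conjugate_set G (h1 \<otimes> h2) W = conjugate_set G h1 (conjugate_set G h2 W)"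
      using Wc by (rule conjugate_set_mult)
    also have "\<dots> \<subseteq> conjugate_set G h1 W" using eng.IH(2) by (auto simp: conjugate_set_eq_image)
    also have "\<dots> \<subseteq> W" by (rule eng.IH(1))
    finally show ?case .
  qed (rule step)
  then have "W \<lhd> G" using W gen by (auto simp: normal_inv_iff conjugate_set_eq_image)
  moreover have "closedin T W" by (rule closedin_open_subgroup[OF W Wo])
  ultimately have "W = {\<one>} \<or> W = carrier G" using simple unfolding topologically_simple_def by blast
  \<comment> \<open>As \<open>W\<close> lies in the proper subgroup \<open>U\<close>, only the
    trivial case is left. Then the identity is an open point, and translation makes \<open>T\<close>
    discrete.\<close>
  then have "W = {\<one>}" using WU U.subset U(3) by blast
  have "openin T {g}" if "g \<in> carrier G" for g
    using openin_l_coset[OF that Wo] that \<open>W = {\<one>}\<close> by (simp add: l_coset_def)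
  then have "discrete_topology (carrier G) = T"
    by (simp add: discrete_topology_unique topspace_eq_carrier)
  then show False using nd by simp
qed

section \<open>The infinite commensurated compact subgroup\<close>

text \<open>For \<open>x \<in> L\<close> the normality of \<open>L\<close> under \<open>V\<close> gives \<open>K x \<subseteq> L K\<close>, and \<open>L\<close> is covered by finitely
  many cosets of \<open>L \<inter> V \<subseteq> K\<close>; so \<open>L\<close> commensurates \<open>K\<close>.\<close>

lemma commensurated_compact_subgroup:
  assumes U: "subgroup U G" "openin T U"
    and \<L>: "finite \<L>" "\<And>L. L \<in> \<L> \<Longrightarrow> locally_normal G T L \<and> compactin T L"
    and inv: "\<And>u L. \<lbrakk>u \<in> U; L \<in> \<L>\<rbrakk> \<Longrightarrow> conjugate_set G u L \<in> \<L>"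
    and gen: "generate G (U \<union> \<Union>\<L>) = carrier G"
    and H: "H \<in> \<L>" "infinite H"
  obtains K where "commensurated G K" "compactin T K" "infinite K" "K \<subseteq> generate G (\<Union>\<L>)"
proof -
  interpret U: subgroup U G by (rule U(1))
  have sub: "subgroup L G" and No: "openin T (normalizer G L)" and Lcomp: "compactin T L"
    if "L \<in> \<L>" for L using \<L>(2)[OF that] by (auto simp: locally_normal_def)
  have Lc: "L \<subseteq> carrier G" if "L \<in> \<L>" for L using subgroup.subset[OF sub[OF that]] .
  define V where "V = U \<inter> ((\<Inter>L\<in>\<L>. normalizer G L) \<inter> topspace T)"
  have Vo: "openin T V" unfolding V_def using U(2) \<L>(1) No by (intro openin_Int openin_INT) auto
  have V: "subgroup V G"
  proof -
    have "subgroup (\<Inter>(insert U (normalizer G ` \<L>))) G"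
      by (rule subgroups_Inter) (use U(1) normalizer_imp_subgroup[OF Lc] in auto)
    moreover have "V = \<Inter>(insert U (normalizer G ` \<L>))"
      using U.subset by (auto simp: V_def topspace_eq_carrier)
    ultimately show ?thesis by simp
  qed
  interpret V: subgroup V G by (rule V)
  have VU: "V \<subseteq> U" by (auto simp: V_def)
  have Vnorm: "v \<otimes> l \<otimes> inv v \<in> L" if "v \<in> V" "L \<in> \<L>" "l \<in> L" for v l L
  proof -
    have "v \<in> normalizer G L" using that by (auto simp: V_def)
    then show ?thesis using that mem_normalizer_iff[OF Lc[OF that(2)]] by (auto simp: conjugate_set_eq_image)
  qed
  \<comment> \<open>Conjugation by \<open>u\<close> sends the normaliser of
    \<open>conjugate_set G (inv u) L\<close> to that of \<open>L\<close>, and both groups belong to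
    \<L>. Hence \<open>U\<close> normalises \<open>V\<close>.\<close>
  have UV: "u \<otimes> v \<otimes> inv u \<in> V" if u: "u \<in> U" and v: "v \<in> V" for u v
  proof -
    have "u \<otimes> v \<otimes> inv u \<in> normalizer G L" if L: "L \<in> \<L>" for L
    proof -
      have "v \<in> normalizer G (conjugate_set G (inv u) L)" using v inv[OF U.m_inv_closed[OF u] L] by (auto simp: V_def)
      then show ?thesis using u by (simp add: normalizer_conjugate_set Lc[OF L])
    qed
    then show ?thesis using u v VU by (auto simp: V_def topspace_eq_carrier)
  qed
  let ?X = "\<Union>((\<lambda>L. L \<inter> V) ` \<L>)"
  define K where "K = generate G ?X"
  have XV: "?X \<subseteq> V" by blast
  have Xc: "?X \<subseteq> carrier G" using XV V.subset by blast
  have K: "subgroup K G" unfolding K_def by (rule generate_is_subgroup[OF Xc])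
  interpret K: subgroup K G by (rule K)
  have KV: "K \<subseteq> V" unfolding K_def by (rule generate_subgroup_incl[OF XV V])
  have LVK: "L \<inter> V \<subseteq> K" if "L \<in> \<L>" for L unfolding K_def using that by (auto intro: generate.incl)
  have "compactin T K" unfolding K_def
  proof (rule compactin_generate_Union_normalized[OF V])
    show "finite ((\<lambda>L. L \<inter> V) ` \<L>)" using \<L>(1) by simp
    fix M assume "M \<in> (\<lambda>L. L \<inter> V) ` \<L>"
    then obtain L where L: "L \<in> \<L>" "M = L \<inter> V" by blast
    have "compactin T M"
      using compact_Int_closedin[OF Lcomp[OF L(1)] closedin_open_subgroup[OF V Vo]] L(2) by simp
    then show "compactin T M \<and> subgroup M G \<and> M \<subseteq> V"
      using L subgroups_Inter_pair[OF sub[OF L(1)] V] by simp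
    fix v m assume "v \<in> V" "m \<in> M"
    then show "v \<otimes> m \<otimes> inv v \<in> M" using L Vnorm by auto
  qed
  moreover have "commensurated G K"
  proof (rule commensuratedI[OF K])
    fix g assume "g \<in> carrier G"
    then have "g \<in> generate G (U \<union> \<Union>\<L>)" using gen by simp
    then show "coset_finite K g"
    proof (rule coset_finite_generate[OF K, rotated -1])
      show "U \<union> \<Union>\<L> \<subseteq> carrier G" using U.subset Lc by blast
      fix x assume x: "x \<in> U \<union> \<Union>\<L>"
      then show "inv x \<in> U \<union> \<Union>\<L>" using sub subgroup.m_inv_closed by fastforce
      show "coset_finite K x"
      proof (cases "x \<in> U")
        case True
        have "K #> x \<subseteq> {x} <#> K"
        proof
          fix y assume "y \<in> K #> x"
          then obtain k where k: "k \<in> K" "y = k \<otimes> x" unfolding r_coset_def by blast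
          \<comment> \<open>An element of \<open>U\<close> maps each generating set
            \<open>L \<inter> V\<close> into another one, so it normalises \<open>K\<close>, and a
            single coset suffices.\<close>
          have "inv x \<otimes> k \<otimes> inv (inv x) \<in> K" unfolding K_def
          proof (rule generate_conjugation_closed[OF _ Xc])
            show "k \<in> generate G ?X" using k by (simp add: K_def)
            fix z assume "z \<in> ?X"
            then obtain L where L: "L \<in> \<L>" "z \<in> L" "z \<in> V" by blast
            have "inv x \<otimes> z \<otimes> inv (inv x) \<in> conjugate_set G (inv x) L"
              using L by (auto simp: conjugate_set_eq_image)
            moreover have "inv x \<otimes> z \<otimes> inv (inv x) \<in> V" using True L by (intro UV) auto
            ultimately show "inv x \<otimes> z \<otimes> inv (inv x) \<in> ?X" using inv[OF U.m_inv_closed[OF True] L(1)] by blast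
          qed (use True in auto)
          moreover have "y = x \<otimes> (inv x \<otimes> k \<otimes> inv (inv x))" using k True by (simp flip: m_assoc)
          ultimately show "y \<in> {x} <#> K" unfolding set_mult_def by blast
        qed
        then show ?thesis unfolding coset_finite_def using True by (intro exI[of _ "{x}"]) auto
      next
        case False
        then obtain L where L: "L \<in> \<L>" "x \<in> L" using x by blast
        obtain F where F: "finite F" "F \<subseteq> L" "L \<subseteq> F <#> (L \<inter> V)"
          using compactin_covered_by_own_cosets[OF Lcomp[OF L(1)] sub[OF L(1)] Vo V.one_closed] .
        have xc: "x \<in> carrier G" using L Lc by blast
        have "K #> x \<subseteq> F <#> K"
        proof
          fix y assume "y \<in> K #> x"
          then obtain k where k: "k \<in> K" "y = k \<otimes> x" unfolding r_coset_def by blast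
          \<comment> \<open>From k x = (k x (inv k)) k, with the bracket in \<open>L\<close> because
            \<open>k\<close> lies in \<open>V\<close>, the finite covering of \<open>L\<close>
            yields f (l k), where l k is in \<open>K\<close>.\<close>
          have "k \<otimes> x \<otimes> inv k \<in> L" using k(1) KV L by (intro Vnorm) auto
          then obtain f l where fl: "f \<in> F" "l \<in> L \<inter> V" "k \<otimes> x \<otimes> inv k = f \<otimes> l"
            using F(3) unfolding set_mult_def by blast
          have lK: "l \<in> K" using fl(2) LVK[OF L(1)] by blast
          have fc: "f \<in> carrier G" using fl(1) F(2) Lc[OF L(1)] by blast
          have "y = (k \<otimes> x \<otimes> inv k) \<otimes> k" using k xc by (simp add: m_assoc)
          also have "\<dots> = f \<otimes> (l \<otimes> k)" using fl(3) fc lK k(1) by (simp add: m_assoc)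
          finally show "y \<in> F <#> K" using fl(1) lK k(1) K.m_closed unfolding set_mult_def by blast
        qed
        then show ?thesis unfolding coset_finite_def using F Lc[OF L(1)] by blast
      qed
    qed
  qed
  moreover have "infinite K"
  proof
    assume fK: "finite K"
    \<comment> \<open>\<open>H\<close> is a finite union of cosets of \<open>H \<inter> V\<close>,
      which lies in \<open>K\<close>; a finite \<open>K\<close> would make \<open>H\<close>
      finite.\<close>
    obtain F where F: "finite F" "F \<subseteq> H" "H \<subseteq> F <#> (H \<inter> V)"
      using compactin_covered_by_own_cosets[OF Lcomp[OF H(1)] sub[OF H(1)] Vo V.one_closed] .
    have "finite (H \<inter> V)" using finite_subset[OF LVK[OF H(1)] fK] .
    then have "finite (F <#> (H \<inter> V))" using F(1) by (auto simp: set_mult_def)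
    then show False using F(3) H(2) finite_subset by blast
  qed
  moreover have "K \<subseteq> generate G (\<Union>\<L>)" unfolding K_def by (rule mono_generate) blast
  ultimately show ?thesis using that by blast
qed

end

section \<open>Generation of the whole group by finitely many conjugates\<close>

theorem corollary5:
  fixes G :: "('a, 'b) monoid_scheme" and T :: "'a topology" and H :: "'a set"
  assumes "class_S G T"
    and "\<And>K. \<lbrakk>commensurated G K; compactin T K; infinite K\<rbrakk> \<Longrightarrow> openin T K"
    and "locally_normal G T H" and "compactin T H" and "H \<noteq> {\<one>\<^bsub>G\<^esub>}"
  shows "\<exists>(n::nat) (g :: nat \<Rightarrow> 'a).
           (\<forall>i\<in>{1..n}. g i \<in> carrier G) \<and>
           carrier G = generate G (\<Union>i\<in>{1..n}. conjugate_set G (g i) H)"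
proof -
  interpret topological_group G T using assms(1) by (simp add: class_S_def)
  let ?\<C> = "(\<lambda>g. conjugate_set G g H) ` carrier G"
  have lc: "locally_compact_space T" and td: "totally_disconnected_space T"
    and nd: "T \<noteq> discrete_topology (carrier G)" and cg: "compactly_generated_group G T"
    and simple: "topologically_simple G T"
    using assms(1) by (auto simp: class_S_def)
  note Hd = Hausdorff_if_totally_disconnected[OF td]
  have H: "subgroup H G" using assms(3) by (simp add: locally_normal_def)
  have Hc: "H \<subseteq> carrier G" by (rule subgroup.subset[OF H])
  have \<C>: "locally_normal G T L" "compactin T L" if "L \<in> ?\<C>" for L
    using that assms(3,4) by (auto intro: locally_normal_conjugate_set compactin_conjugate_set)
  \<comment> \<open>Removing a non-trivial element \<open>a\<close> from the prescribed
    neighbourhood forces \<open>U\<close> to be proper, as is required to exclude a finite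
    \<open>H\<close>.\<close>
  obtain a where a: "a \<in> carrier G" "a \<noteq> \<one>\<^bsub>G\<^esub>" using simple by (auto simp: topologically_simple_def)
  have "closedin T {a}"
    using a by (intro closedin_Hausdorff_finite[OF Hd]) (auto simp: topspace_eq_carrier)
  then have "openin T (carrier G - {a})" using topspace_eq_carrier by (metis openin_diff openin_topspace)
  moreover have "\<one>\<^bsub>G\<^esub> \<in> carrier G - {a}" using a by auto
  ultimately obtain U where U: "subgroup U G" "openin T U" "compactin T U" "U \<subseteq> carrier G - {a}"
    using compact_open_subgroup_exists[OF lc td] by metis
  obtain \<L>0 where \<L>0: "finite \<L>0" "\<L>0 \<subseteq> ?\<C>" "generate G (U \<union> \<Union>\<L>0) = carrier G"
    using generate_open_subgroup_Un_conjugates[OF cg simple H assms(5) U(1,2)] .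
  have HC: "H \<in> ?\<C>" using conjugate_set_one[OF Hc] by (metis imageI one_closed)
  \<comment> \<open>\<open>H\<close> itself is put into the family so that some member is known to
    be infinite; this makes \<open>K\<close> infinite.\<close>
  then have "finite (insert H \<L>0)" "insert H \<L>0 \<subseteq> ?\<C>" using \<L>0 by auto
  then obtain \<L> where \<L>: "finite \<L>" "insert H \<L>0 \<subseteq> \<L>" "\<L> \<subseteq> ?\<C>"
    "\<And>u L. \<lbrakk>u \<in> U; L \<in> \<L>\<rbrakk> \<Longrightarrow> conjugate_set G u L \<in> \<L>"
    using finite_invariant_conjugates[OF U(1,3) assms(3)] by metis
  have \<C>c: "\<Union>?\<C> \<subseteq> carrier G" using conjugate_set_subset_carrier[OF _ Hc] by blast
  have \<L>c: "U \<union> \<Union>\<L> \<subseteq> carrier G" using U(4) \<L>(3) \<C>c by blast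
  have gen: "generate G (U \<union> \<Union>\<L>) = carrier G"
  proof (rule generate_eqI[OF \<L>0(3) _ \<L>c])
    have "U \<union> \<Union>\<L>0 \<subseteq> U \<union> \<Union>\<L>" using \<L>(2) by blast
    then show "U \<union> \<Union>\<L>0 \<subseteq> generate G (U \<union> \<Union>\<L>)" by (blast intro: generate.incl)
  qed
  have "infinite H"
  proof
    assume "finite H"
    then have "locally_normal G T L \<and> finite L" if "L \<in> \<L>" for L
      using that \<L>(3) \<C>(1) by (auto simp: conjugate_set_eq_image)
    moreover have "U \<noteq> carrier G" using U(4) a(1) by blast
    ultimately show False
      using generate_Un_finite_locally_normal_ne_carrier[OF Hd simple nd U(1,2) _ \<L>(1) _ \<L>(4)] gen by blast
  qed
  moreover have "H \<in> \<L>" using \<L>(2) by simp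
  moreover have "locally_normal G T L \<and> compactin T L" if "L \<in> \<L>" for L using that \<L>(3) \<C> by blast
  ultimately obtain K where K: "commensurated G K" "compactin T K" "infinite K" "K \<subseteq> generate G (\<Union>\<L>)"
    using commensurated_compact_subgroup[OF U(1,2) \<L>(1) _ \<L>(4) gen] by metis
  have "subgroup K G" using K(1) by (simp add: commensurated_def)
  moreover have "openin T K" using K(1-3) by (rule assms(2))
  ultimately obtain \<M> where \<M>: "finite \<M>" "\<M> \<subseteq> ?\<C>" "generate G (K \<union> \<Union>\<M>) = carrier G"
    by (rule generate_open_subgroup_Un_conjugates[OF cg simple H assms(5)])
  \<comment> \<open>The open subgroup \<open>K\<close> is itself generated from within \<L>, so it
    can be replaced by \<L> in the generating set with \<M>.\<close>
  have "generate G (\<Union>(\<L> \<union> \<M>)) = carrier G"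
  proof (rule generate_eqI[OF \<M>(3)])
    have "generate G (\<Union>\<L>) \<subseteq> generate G (\<Union>(\<L> \<union> \<M>))" by (rule mono_generate) blast
    then show "K \<union> \<Union>\<M> \<subseteq> generate G (\<Union>(\<L> \<union> \<M>))" using K(4) by (auto intro: generate.incl)
    show "\<Union>(\<L> \<union> \<M>) \<subseteq> carrier G" using \<L>(3) \<M>(2) \<C>c by blast
  qed
  moreover have "finite (\<L> \<union> \<M>)" "\<L> \<union> \<M> \<subseteq> ?\<C>" using \<L>(1,3) \<M>(1,2) by auto
  then have "\<exists>F\<subseteq>carrier G. finite F \<and> \<L> \<union> \<M> = (\<lambda>g. conjugate_set G g H) ` F"
    by (rule finite_subset_image)
  then obtain F where F: "F \<subseteq> carrier G" "finite F" "\<L> \<union> \<M> = (\<lambda>g. conjugate_set G g H) ` F"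
    by blast
  \<comment> \<open>The conjugating elements are numbered from 1 to \<open>card F\<close>, to match
    the index range of the conclusion.\<close>
  obtain h where "bij_betw h {1..card F} F" using ex_bij_betw_nat_finite_1[OF F(2)] by blast
  then have h: "F = h ` {1..card F}" by (simp add: bij_betw_def)
  have "\<L> \<union> \<M> = (\<lambda>i. conjugate_set G (h i) H) ` {1..card F}"
    unfolding F(3) by (subst h) (rule image_image)
  ultimately have "carrier G = generate G (\<Union>i\<in>{1..card F}. conjugate_set G (h i) H)" by simp
  moreover have "\<forall>i\<in>{1..card F}. h i \<in> carrier G" using h F(1) by blast
  ultimately show ?thesis by blast
qed

end
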